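(* Let $\mathcal{H}$ be a complex Hilbert space. The maps $\alpha:\mathcal{I}(\mathcal{H})\to\mathcal{P}(\mathcal{H})$, $\alpha(V)=V^*V$, and $\omega:\mathcal{I}(\mathcal{H})\to\mathcal{P}(\mathcal{H})$, $\omega(V)=VV^*$, are distance decreasing; i.e., if $V_1,V_2\in\mathcal{I}(\mathcal{H})$, $E_j=\alpha(V_j)$ and $F_j=\omega(V_j)$ for $j=1,2$, then $$d_{\mathcal{P}(\mathcal{H})}(E_1,E_2)\le d_{\mathcal{I}(\mathcal{H})}(V_1,V_2)\quad\text{and}\quad d_{\mathcal{P}(\mathcal{H})}(F_1,F_2)\le d_{\mathcal{I}(\mathcal{H})}(V_1,V_2).$$
   Context: $\mathcal{I}(\mathcal{H})=\{V\in\mathcal{B}(\mathcal{H}): VV^*V=V\}$ is the set of partial isometries, a submanifold of $\mathcal{B}(\mathcal{H})$ with tangent spaces $(T\mathcal{I}(\mathcal{H}))_V=\{iXV-iVY: X^*=X,\ Y^*=Y\in\mathcal{B}(\mathcal{H})\}$ and Finsler norm $$|v|_V=\inf\{\max\{\|A\|,\|B\|\}: A^*=A,\ B^*=B\in\mathcal{B}(\mathcal{H}),\ iAV-iVB=v\}.$$ $\mathcal{P}(\mathcal{H})$ is the set of orthogonal projections in $\mathcal{B}(\mathcal{H})$, a submanifold of $\mathcal{B}(\mathcal{H})$; each of its tangent spaces is given the operator norm of $\mathcal{B}(\mathcal{H})$. For a manifold $M$ with a Finsler norm $|\cdot|_m$ on each tangent space, $d_M(m_1,m_2)=\inf\{\ell(\gamma)\}$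 over smooth curves $\gamma:[a,b]\to M$ with $\gamma(a)=m_1$, $\gamma(b)=m_2$, where $\ell(\gamma)=\int_a^b|\dot\gamma(t)|_{\gamma(t)}\,dt$; the infimum over the empty set is $+\infty$. *)

theory Defs
  imports "HOL-Analysis.Analysis"
begin

text \<open>
  A complex Hilbert space is a complete real inner product space with a compatible complex
  vector space structure and a complex inner product (linear in the first argument) whose real
  part is the real inner product. Norm and topology come from \<open>real_inner\<close>, so that
  \<open>norm x = sqrt (Re (cinner x x))\<close>. Neither separability nor a nonzero dimension is required.
\<close>

class complex_hilbert = real_inner + banach +
  fixes scaleC :: "complex \<Rightarrow> 'a \<Rightarrow> 'a"  (infixr \<open>*\<^sub>C\<close> 75)
    and cinner :: "'a \<Rightarrow> 'a \<Rightarrow> complex"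
  assumes scaleC_add_right: "c *\<^sub>C (x + y) = c *\<^sub>C x + c *\<^sub>C y"
    and scaleC_add_left: "(c + d) *\<^sub>C x = c *\<^sub>C x + d *\<^sub>C x"
    and scaleC_scaleC: "c *\<^sub>C (d *\<^sub>C x) = (c * d) *\<^sub>C x"
    and scaleR_scaleC: "r *\<^sub>R x = complex_of_real r *\<^sub>C x"
    and cinner_commute: "cinner x y = cnj (cinner y x)"
    and cinner_add_left: "cinner (x + y) z = cinner x z + cinner y z"
    and cinner_scaleC_left: "cinner (c *\<^sub>C x) y = c * cinner x y"
    and inner_eq_Re_cinner: "x \<bullet> y = Re (cinner x y)"

lemma norm_scaleC: "norm (c *\<^sub>C x) = cmod c * norm (x :: 'a :: complex_hilbert)"
proof -
  have "cinner (c *\<^sub>C x) (c *\<^sub>C x) = c * cnj (cinner (c *\<^sub>C x) x)"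
    by (metis cinner_commute cinner_scaleC_left)
  also have "\<dots> = (c * cnj c) * cinner x x"
    by (metis cinner_commute cinner_scaleC_left complex_cnj_mult mult.assoc)
  finally have "(c *\<^sub>C x) \<bullet> (c *\<^sub>C x) = (cmod c)\<^sup>2 * (x \<bullet> x)"
    by (simp add: inner_eq_Re_cinner flip: complex_norm_square)
  then show ?thesis
    by (simp add: norm_eq_sqrt_inner real_sqrt_mult)
qed

instantiation complex :: complex_hilbert
begin

definition scaleC_complex :: "complex \<Rightarrow> complex \<Rightarrow> complex" where
  "scaleC_complex c x = c * x"

definition cinner_complex :: "complex \<Rightarrow> complex \<Rightarrow> complex" where
  "cinner_complex x y = x * cnj y"

instance
  by standard
    (auto simp: scaleC_complex_def cinner_complex_def inner_complex_def scaleR_conv_of_real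
      algebra_simps)

end


text \<open>
  Type \<open>'a \<Rightarrow>\<^sub>L 'a\<close> consists of the bounded real-linear operators with the operator norm;
  \<open>bounded_operators\<close>, the algebra \<open>B(H)\<close>, is the subspace of the complex-linear ones.
\<close>

definition bounded_operators :: "('a::complex_hilbert \<Rightarrow>\<^sub>L 'a) set" where
  "bounded_operators = {T. \<forall>c x. blinfun_apply T (c *\<^sub>C x) = c *\<^sub>C blinfun_apply T x}"

lift_definition scaleC_op ::
  "complex \<Rightarrow> ('a::complex_hilbert \<Rightarrow>\<^sub>L 'a) \<Rightarrow> ('a \<Rightarrow>\<^sub>L 'a)"
  is "\<lambda>c T x. c *\<^sub>C T x"
proof -
  fix c :: complex and T :: "'a \<Rightarrow> 'a"
  assume T: "bounded_linear T"
  have "bounded_linear (\<lambda>x::'a. c *\<^sub>C x)"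
    by (rule bounded_linear_intro[where K = "cmod c"])
      (simp_all add: scaleC_add_right scaleR_scaleC scaleC_scaleC mult.commute norm_scaleC)
  then show "bounded_linear (\<lambda>x. c *\<^sub>C T x)"
    using T by (rule bounded_linear_compose)
qed

text \<open>The Hilbert space adjoint; it exists by the Riesz representation theorem.\<close>

definition adj :: "('a::complex_hilbert \<Rightarrow>\<^sub>L 'a) \<Rightarrow> ('a \<Rightarrow>\<^sub>L 'a)" where
  "adj T = (THE S. S \<in> bounded_operators \<and>
     (\<forall>x y. cinner (blinfun_apply T x) y = cinner x (blinfun_apply S y)))"

definition selfadjoint_operators :: "('a::complex_hilbert \<Rightarrow>\<^sub>L 'a) set" where
  "selfadjoint_operators = {A \<in> bounded_operators. adj A = A}"

definition projections :: "('a::complex_hilbert \<Rightarrow>\<^sub>L 'a) set" where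
  "projections = {P \<in> selfadjoint_operators. P o\<^sub>L P = P}"

definition partial_isometries :: "('a::complex_hilbert \<Rightarrow>\<^sub>L 'a) set" where
  "partial_isometries = {V \<in> bounded_operators. V o\<^sub>L adj V o\<^sub>L V = V}"

definition initial_projection :: "('a::complex_hilbert \<Rightarrow>\<^sub>L 'a) \<Rightarrow> ('a \<Rightarrow>\<^sub>L 'a)" where
  "initial_projection V = adj V o\<^sub>L V"

definition final_projection :: "('a::complex_hilbert \<Rightarrow>\<^sub>L 'a) \<Rightarrow> ('a \<Rightarrow>\<^sub>L 'a)" where
  "final_projection V = V o\<^sub>L adj V"

text \<open>
  Meaningful for \<open>v\<close> in the tangent space \<open>{iXV - iVY | X Y selfadjoint}\<close> at \<open>V\<close>, which is
  exactly when the infimum is over a nonempty set.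
\<close>

definition partial_isometry_norm ::
  "('a::complex_hilbert \<Rightarrow>\<^sub>L 'a) \<Rightarrow> ('a \<Rightarrow>\<^sub>L 'a) \<Rightarrow> real" where
  "partial_isometry_norm V v =
     Inf {max (norm A) (norm B) | A B.
       A \<in> selfadjoint_operators \<and> B \<in> selfadjoint_operators \<and>
       scaleC_op \<i> (A o\<^sub>L V) - scaleC_op \<i> (V o\<^sub>L B) = v}"


text \<open>
  \<open>C\<^sup>\<infinity>\<close> on the closed interval, with one-sided derivatives at the end points. For a
  submanifold \<open>M\<close> of a Banach space, a curve in \<open>M\<close> is smooth iff it is smooth as a curve
  in the ambient space; \<open>D n\<close> is its derivative of order \<open>n\<close>.
\<close>

definition smooth_curve_on :: "real \<Rightarrow> real \<Rightarrow> (real \<Rightarrow> 'b::real_normed_vector) \<Rightarrow> bool" where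
  "smooth_curve_on a b \<gamma> \<longleftrightarrow>
     (\<exists>D :: nat \<Rightarrow> real \<Rightarrow> 'b. (\<forall>t\<in>{a..b}. D 0 t = \<gamma> t) \<and>
        (\<forall>n. \<forall>t\<in>{a..b}. (D n has_vector_derivative D (Suc n) t) (at t within {a..b})))"

text \<open>
  \<open>N m v\<close> is the Finsler norm of the tangent vector \<open>v\<close> at the point \<open>m\<close>. The integrand is
  nonnegative, so the length is a nonnegative Lebesgue integral, and distances take values in
  \<open>[0, \<infinity>]\<close>, where the infimum over the empty set is \<open>\<infinity>\<close>.
\<close>

definition curve_length ::
  "('b \<Rightarrow> 'b \<Rightarrow> real) \<Rightarrow> real \<Rightarrow> real \<Rightarrow> (real \<Rightarrow> 'b::real_normed_vector) \<Rightarrow> ennreal" where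
  "curve_length N a b \<gamma> =
     (\<integral>\<^sup>+t\<in>{a..b}. ennreal (N (\<gamma> t) (vector_derivative \<gamma> (at t within {a..b}))) \<partial>lborel)"

definition finsler_dist ::
  "'b set \<Rightarrow> ('b \<Rightarrow> 'b \<Rightarrow> real) \<Rightarrow> 'b::real_normed_vector \<Rightarrow> 'b \<Rightarrow> ennreal" where
  "finsler_dist M N m1 m2 =
     Inf {curve_length N a b \<gamma> | a b \<gamma>. a < b \<and> smooth_curve_on a b \<gamma> \<and>
       \<gamma> ` {a..b} \<subseteq> M \<and> \<gamma> a = m1 \<and> \<gamma> b = m2}"

definition partial_isometry_dist ::
  "('a::complex_hilbert \<Rightarrow>\<^sub>L 'a) \<Rightarrow> ('a \<Rightarrow>\<^sub>L 'a) \<Rightarrow> ennreal" where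
  "partial_isometry_dist = finsler_dist partial_isometries partial_isometry_norm"

definition projection_dist ::
  "('a::complex_hilbert \<Rightarrow>\<^sub>L 'a) \<Rightarrow> ('a \<Rightarrow>\<^sub>L 'a) \<Rightarrow> ennreal" where
  "projection_dist = finsler_dist projections (\<lambda>P v. norm v)"

end

theory Submission
  imports Defs
begin

text \<open>
  Along a smooth curve \<open>V\<close> of partial isometries with velocity \<open>v = iAV - iVB\<close>, where \<open>A\<close> and
  \<open>B\<close> are selfadjoint, the product rule makes the velocities of the projections \<open>E = V\<^sup>*V\<close> and
  \<open>F = VV\<^sup>*\<close> the commutators \<open>i(BE - EB)\<close> and \<open>i(AF - FA)\<close>
  (\<open>norm_initial_derivative_le\<close>, \<open>norm_final_derivative_le\<close>). Commuting with a projection keeps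
  only the two off-diagonal corners of an operator, so it does not increase the norm
  (\<open>norm_commutator_projection_le\<close>). Hence both speeds are at most \<open>max \<parallel>A\<parallel> \<parallel>B\<parallel>\<close> for every
  such pair \<open>(A, B)\<close>, thus at most the Finsler norm of \<open>v\<close>. Integrating bounds the length of
  each image curve by that of the original one, and the infimum over curves gives the claim.

  The infimum of the empty set of reals is an uncontrolled value, so this needs every velocity to
  have a decomposition \<open>iAV - iVB\<close> in the first place. Differentiating \<open>VV\<^sup>*V = V\<close> gives
  \<open>vV\<^sup>*V + Vv\<^sup>*V + VV\<^sup>*v = v\<close>, and \<open>tangent_vector_decomposition\<close> solves for \<open>A\<close> and \<open>B\<close>
  explicitly from this equation.

  Smoothness of the image curves requires the adjoint to be a bounded linear map on the ambient
  space, which consists of all bounded real-linear operators, whereas \<open>adj\<close> is characterised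
  only on the complex-linear ones. The adjoint with respect to the real inner product,
  \<open>real_adjoint\<close>, exists for every operator by the Riesz representation theorem, is linear and
  contractive, and agrees with \<open>adj\<close> on complex-linear operators (\<open>adj_eq_real_adjoint\<close>).
\<close>

section \<open>The Riesz representation theorem and real adjoints\<close>

text \<open>
  The representing vector is the minimiser of the energy \<open>\<phi>(x) = \<parallel>x\<parallel>\<^sup>2 / 2 - f(x)\<close>: the
  parallelogram law makes minimising sequences Cauchy, and the vanishing of the first variation
  at the minimiser \<open>u\<close> in direction \<open>h\<close> reads \<open>h \<bullet> u = f(h)\<close>.
\<close>

theorem riesz_representation:
  fixes f :: "'a::{real_inner,banach} \<Rightarrow> real"
  assumes "bounded_linear f"
  obtains u where "\<And>x. f x = x \<bullet> u"
proof -
  interpret f: bounded_linear f by fact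
  define \<phi> where "\<phi> x = (x \<bullet> x) / 2 - f x" for x
  define m where "m = (INF x. \<phi> x)"
  obtain K where K: "\<And>x. norm (f x) \<le> norm x * K"
    using f.bounded by blast
  have lower: "- (K\<^sup>2 / 2) \<le> \<phi> x" for x
  proof -
    have "f x \<le> norm x * K"
      using K[of x] by simp
    moreover have "0 \<le> (norm x - K)\<^sup>2" by simp
    then have "norm x * K \<le> (x \<bullet> x) / 2 + K\<^sup>2 / 2"
      by (simp add: power2_diff power2_norm_eq_inner)
    ultimately show ?thesis by (simp add: \<phi>_def)
  qed
  have bdd: "bdd_below (range \<phi>)"
    using lower by (intro bdd_belowI2[where m = "- (K\<^sup>2 / 2)"])
  have m_le: "m \<le> \<phi> x" for x
    unfolding m_def using bdd by (simp add: cINF_lower)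
  have "\<exists>x. \<phi> x < m + inverse (real (Suc n))" for n
  proof -
    have "m < m + inverse (real (Suc n))" by simp
    then show ?thesis
      using cINF_less_iff[of UNIV \<phi>] bdd unfolding m_def by blast
  qed
  then obtain X where X: "\<And>n. \<phi> (X n) < m + inverse (real (Suc n))"
    by metis
  have parallelogram:
    "(dist x y)\<^sup>2 = 4 * (\<phi> x + \<phi> y - 2 * \<phi> ((1/2) *\<^sub>R (x + y)))" for x y
    by (simp add: \<phi>_def dist_norm power2_norm_eq_inner f.scaleR f.add inner_diff
        inner_add inner_commute algebra_simps)
  have "Cauchy X"
  proof (rule metric_CauchyI)
    fix e :: real
    assume "0 < e"
    then obtain M where M: "inverse (real (Suc M)) < e\<^sup>2 / 8"
      using reals_Archimedean[of "e\<^sup>2 / 8"] by auto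
    have "dist (X p) (X q) < e" if "M \<le> p" "M \<le> q" for p q
    proof -
      have "inverse (real (Suc p)) \<le> inverse (real (Suc M))" "inverse (real (Suc q)) \<le> inverse (real (Suc M))"
        using that by (auto simp: field_simps)
      then have "(dist (X p) (X q))\<^sup>2 < e\<^sup>2"
        unfolding parallelogram
        using X[of p] X[of q] m_le[of "(1/2) *\<^sub>R (X p + X q)"] M
        by argo
      then show ?thesis
        using \<open>0 < e\<close> by (simp add: power2_less_imp_less)
    qed
    then show "\<exists>M. \<forall>p\<ge>M. \<forall>q\<ge>M. dist (X p) (X q) < e" by blast
  qed
  then obtain u where u: "X \<longlonglongrightarrow> u"
    using Cauchy_convergent convergent_def by blast
  have lim: "(\<lambda>n. \<phi> (X n)) \<longlonglongrightarrow> \<phi> u"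
    unfolding \<phi>_def by (intro tendsto_intros f.tendsto u) auto
  have lim_bound: "(\<lambda>n. m + inverse (real (Suc n))) \<longlonglongrightarrow> m + 0"
    by (intro tendsto_add tendsto_const LIMSEQ_inverse_real_of_nat)
  have "\<phi> u \<le> m"
    using LIMSEQ_le[OF lim lim_bound] X by (auto intro: less_imp_le)
  then have minimal: "\<phi> u \<le> \<phi> x" for x
    using m_le[of x] by simp
  have "f h = h \<bullet> u" for h
  proof (cases "h = 0")
    case False
    define c where "c = h \<bullet> u - f h"
    \<comment> \<open>the step \<open>t\<close> minimises the quadratic \<open>\<phi>(u + t h) - \<phi>(u) = t c + t\<^sup>2 \<parallel>h\<parallel>\<^sup>2 / 2\<close>\<close>
    define t where "t = - (c / (h \<bullet> h))"
    have pos: "0 < h \<bullet> h" using False by simp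
    have "\<phi> (u + t *\<^sub>R h) - \<phi> u = t * c + t\<^sup>2 * (h \<bullet> h) / 2"
      by (simp add: \<phi>_def c_def f.scaleR f.add inner_diff inner_add inner_commute
          algebra_simps power2_eq_square)
    also have "\<dots> = - (c\<^sup>2 / (2 * (h \<bullet> h)))"
      using pos by (simp add: t_def field_simps power2_eq_square)
    finally have "c\<^sup>2 / (2 * (h \<bullet> h)) \<le> 0"
      using minimal[of "u + t *\<^sub>R h"] by simp
    then have "c = 0"
      using pos by (simp add: divide_le_0_iff)
    then show ?thesis by (simp add: c_def)
  qed (simp add: f.zero)
  then show thesis by (rule that)
qed

text \<open>
  On a complex-linear operator this is the usual Hilbert space adjoint, but it is meaningful for
  every bounded real-linear operator.
\<close>

definition real_adjoint :: "('a::{real_inner,banach} \<Rightarrow>\<^sub>L 'a) \<Rightarrow> ('a \<Rightarrow>\<^sub>L 'a)" where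
  "real_adjoint T = Blinfun (adjoint (blinfun_apply T))"

lemma
  fixes T :: "'a::{real_inner,banach} \<Rightarrow>\<^sub>L 'a"
  shows inner_real_adjoint: "blinfun_apply T x \<bullet> y = x \<bullet> blinfun_apply (real_adjoint T) y"
    and norm_real_adjoint_apply: "norm (blinfun_apply (real_adjoint T) y) \<le> norm y * norm T"
proof -
  have "\<exists>u. \<forall>x. T x \<bullet> y = x \<bullet> u" for y
    by (rule riesz_representation[of "\<lambda>x. T x \<bullet> y"])
      (auto intro: bounded_linear_compose[OF bounded_linear_inner_left blinfun.bounded_linear_right])
  then obtain S where S: "\<And>x y. T x \<bullet> y = x \<bullet> S y"
    by metis
  have adj: "adjoint T = S"
    using S by (intro adjoint_unique) blast
  have bound: "norm (S y) \<le> norm y * norm T" for y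
  proof (cases "S y = 0")
    case False
    have "norm (S y) * norm (S y) = T (S y) \<bullet> y"
      by (simp add: S flip: power2_norm_eq_inner power2_eq_square)
    also have "\<dots> \<le> norm (T (S y)) * norm y"
      by (rule norm_cauchy_schwarz)
    also have "\<dots> \<le> (norm T * norm (S y)) * norm y"
      by (intro mult_right_mono norm_blinfun) simp
    finally have "norm (S y) * norm (S y) \<le> norm (S y) * (norm y * norm T)"
      by (simp add: mult_ac)
    then show ?thesis using False by simp
  qed simp
  have "bounded_linear S"
  proof (rule bounded_linear_intro[where K = "norm T"])
    show "S (x + y) = S x + S y" for x y
      by (rule vector_eq_ldot[THEN iffD1]) (simp add: inner_add flip: S)
    show "S (r *\<^sub>R x) = r *\<^sub>R S x" for r x
      by (rule vector_eq_ldot[THEN iffD1]) (simp flip: S)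
  qed (rule bound)
  then have apply_eq: "blinfun_apply (real_adjoint T) = S"
    by (simp add: real_adjoint_def adj bounded_linear_Blinfun_apply)
  show "T x \<bullet> y = x \<bullet> real_adjoint T y" "norm (real_adjoint T y) \<le> norm y * norm T"
    by (simp_all add: apply_eq S bound)
qed

lemma real_adjoint_unique:
  assumes "\<And>x y. blinfun_apply T x \<bullet> y = x \<bullet> blinfun_apply S y"
  shows "real_adjoint T = S"
proof (rule blinfun_eqI)
  show "real_adjoint T y = S y" for y
    by (rule vector_eq_ldot[THEN iffD1]) (simp add: assms flip: inner_real_adjoint)
qed

lemma real_adjoint_involutive [simp]: "real_adjoint (real_adjoint T) = T"
  by (intro real_adjoint_unique) (metis inner_commute inner_real_adjoint)

lemma real_adjoint_add: "real_adjoint (S + T) = real_adjoint S + real_adjoint T"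
  by (intro real_adjoint_unique)
    (simp add: blinfun.bilinear_simps inner_add inner_real_adjoint)

lemma real_adjoint_diff: "real_adjoint (S - T) = real_adjoint S - real_adjoint T"
  by (intro real_adjoint_unique)
    (simp add: blinfun.bilinear_simps inner_diff inner_real_adjoint)

lemma real_adjoint_compose: "real_adjoint (S o\<^sub>L T) = real_adjoint T o\<^sub>L real_adjoint S"
  by (intro real_adjoint_unique) (simp add: inner_real_adjoint)

lemma bounded_linear_real_adjoint: "bounded_linear real_adjoint"
proof (rule bounded_linear_intro[where K = 1])
  show "real_adjoint (r *\<^sub>R T) = r *\<^sub>R real_adjoint T" for r and T :: "'a \<Rightarrow>\<^sub>L 'a"
    by (intro real_adjoint_unique) (simp add: blinfun.bilinear_simps inner_real_adjoint)
  show "norm (real_adjoint T) \<le> norm T * 1" for T :: "'a \<Rightarrow>\<^sub>L 'a"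
    by (rule norm_blinfun_bound) (simp_all add: norm_real_adjoint_apply mult.commute)
qed (rule real_adjoint_add)


section \<open>The algebra of complex-linear operators\<close>

lemma scaleC_diff_right: "c *\<^sub>C (x - y) = c *\<^sub>C x - c *\<^sub>C (y::'a::complex_hilbert)"
  by (metis add_diff_cancel diff_add_cancel scaleC_add_right)

lemma scaleC_one [simp]: "1 *\<^sub>C (x::'a::complex_hilbert) = x"
  using scaleR_scaleC[of 1 x] by simp

lemma scaleC_minus_right: "c *\<^sub>C (- x) = - (c *\<^sub>C (x::'a::complex_hilbert))"
  using scaleC_diff_right[of c 0 x] scaleC_diff_right[of c 0 0] by simp

lemma scaleC_minus_left: "(- c) *\<^sub>C x = - (c *\<^sub>C (x::'a::complex_hilbert))"
proof -
  have "(- c) *\<^sub>C x + c *\<^sub>C x = 0 *\<^sub>C x"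
    by (simp flip: scaleC_add_left)
  also have "\<dots> = 0"
    using scaleR_scaleC[of 0 x] by simp
  finally show ?thesis by (simp add: eq_neg_iff_add_eq_0)
qed

lemma inner_scaleC_left: "(c *\<^sub>C x) \<bullet> y = x \<bullet> (cnj c *\<^sub>C (y::'a::complex_hilbert))"
  unfolding inner_eq_Re_cinner
  by (metis cinner_commute cinner_scaleC_left complex_cnj_cnj complex_cnj_mult)

text \<open>
  The complex inner product is recovered from the real one by polarisation in \<open>\<i>\<close>, so an adjoint
  for \<open>(\<bullet>)\<close> that commutes with \<open>\<i>\<close> is an adjoint for \<open>cinner\<close>.
\<close>

lemma cinner_inner: "cinner x y = Complex (x \<bullet> y) (x \<bullet> (\<i> *\<^sub>C (y::'a::complex_hilbert)))"
  by (simp add: complex_eq_iff inner_eq_Re_cinner cinner_scaleC_left cinner_commute[of x])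

lemma scaleC_op_apply [simp]: "blinfun_apply (scaleC_op c T) x = c *\<^sub>C blinfun_apply T x"
  by transfer simp

lemma bounded_operators_scaleC:
  "T \<in> bounded_operators \<Longrightarrow> blinfun_apply T (c *\<^sub>C x) = c *\<^sub>C blinfun_apply T x"
  by (simp add: bounded_operators_def)

lemma bounded_operators_closed:
  assumes "S \<in> bounded_operators" "T \<in> bounded_operators"
  shows "S o\<^sub>L T \<in> bounded_operators" "S + T \<in> bounded_operators" "S - T \<in> bounded_operators"
  using assms
  by (auto simp: bounded_operators_def blinfun.bilinear_simps scaleC_add_right scaleC_diff_right)

lemma scaleC_op_bounded_operators:
  "T \<in> bounded_operators \<Longrightarrow> scaleC_op c T \<in> bounded_operators"
  by (simp add: bounded_operators_def scaleC_scaleC mult.commute)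

lemma real_adjoint_bounded_operators:
  assumes "T \<in> bounded_operators"
  shows "real_adjoint T \<in> bounded_operators"
  unfolding bounded_operators_def
proof (intro CollectI allI)
  fix c x
  show "real_adjoint T (c *\<^sub>C x) = c *\<^sub>C real_adjoint T x"
  proof (rule vector_eq_ldot[THEN iffD1], intro allI)
    fix z
    have "z \<bullet> real_adjoint T (c *\<^sub>C x) = T (cnj c *\<^sub>C z) \<bullet> x"
      by (simp add: bounded_operators_scaleC[OF assms] inner_scaleC_left flip: inner_real_adjoint)
    also have "\<dots> = z \<bullet> (c *\<^sub>C real_adjoint T x)"
      by (simp add: inner_real_adjoint inner_scaleC_left)
    finally show "z \<bullet> real_adjoint T (c *\<^sub>C x) = z \<bullet> (c *\<^sub>C real_adjoint T x)" .
  qed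
qed

lemma adj_eq_real_adjoint:
  assumes "T \<in> bounded_operators"
  shows "adj T = real_adjoint T"
  unfolding adj_def
proof (rule the_equality)
  have "cinner (T x) y = cinner x (real_adjoint T y)" for x y
    using real_adjoint_bounded_operators[OF assms]
    by (simp add: cinner_inner inner_real_adjoint bounded_operators_scaleC)
  then show "real_adjoint T \<in> bounded_operators \<and>
      (\<forall>x y. cinner (T x) y = cinner x (real_adjoint T y))"
    using real_adjoint_bounded_operators[OF assms] by blast
  show "S = real_adjoint T"
    if "S \<in> bounded_operators \<and> (\<forall>x y. cinner (T x) y = cinner x (S y))" for S
    by (rule real_adjoint_unique[symmetric]) (simp add: that inner_eq_Re_cinner)
qed

lemma real_adjoint_scaleC_op:
  assumes "T \<in> bounded_operators"
  shows "real_adjoint (scaleC_op c T) = scaleC_op (cnj c) (real_adjoint T)"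
  by (intro real_adjoint_unique)
    (simp add: inner_scaleC_left inner_real_adjoint
      bounded_operators_scaleC[OF real_adjoint_bounded_operators[OF assms]])

lemma selfadjoint_operators_iff:
  "A \<in> selfadjoint_operators \<longleftrightarrow> A \<in> bounded_operators \<and> real_adjoint A = A"
  by (auto simp: selfadjoint_operators_def adj_eq_real_adjoint)

lemma projections_iff:
  "P \<in> projections \<longleftrightarrow> P \<in> bounded_operators \<and> real_adjoint P = P \<and> P o\<^sub>L P = P"
  by (auto simp: projections_def selfadjoint_operators_iff)

lemma partial_isometries_iff:
  "V \<in> partial_isometries \<longleftrightarrow> V \<in> bounded_operators \<and> V o\<^sub>L real_adjoint V o\<^sub>L V = V"
  by (auto simp: partial_isometries_def adj_eq_real_adjoint)

lemma partial_isometriesD: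
  assumes "V \<in> partial_isometries"
  shows "V \<in> bounded_operators"
    "V o\<^sub>L real_adjoint V o\<^sub>L V = V"
    "blinfun_apply V (blinfun_apply (real_adjoint V) (blinfun_apply V x)) = blinfun_apply V x"
    "blinfun_apply (real_adjoint V) (blinfun_apply V (blinfun_apply (real_adjoint V) x))
      = blinfun_apply (real_adjoint V) x"
    "initial_projection V = real_adjoint V o\<^sub>L V"
    "final_projection V = V o\<^sub>L real_adjoint V"
proof -
  show V: "V \<in> bounded_operators" "V o\<^sub>L real_adjoint V o\<^sub>L V = V"
    using assms by (auto simp: partial_isometries_iff)
  show "V (real_adjoint V (V x)) = V x"
    using arg_cong[OF V(2), of "\<lambda>T. blinfun_apply T x"] by simp
  show "real_adjoint V (V (real_adjoint V x)) = real_adjoint V x"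
    using arg_cong[OF V(2), of "\<lambda>T. blinfun_apply (real_adjoint T) x"]
    by (simp add: real_adjoint_compose)
  show "initial_projection V = real_adjoint V o\<^sub>L V" "final_projection V = V o\<^sub>L real_adjoint V"
    by (simp_all add: initial_projection_def final_projection_def adj_eq_real_adjoint V)
qed

lemma initial_projection_in_projections:
  assumes "V \<in> partial_isometries"
  shows "initial_projection V \<in> projections"
  unfolding projections_iff partial_isometriesD(5)[OF assms]
  by (auto simp: partial_isometriesD[OF assms] bounded_operators_closed
      real_adjoint_bounded_operators real_adjoint_compose intro!: blinfun_eqI)

lemma final_projection_in_projections:
  assumes "V \<in> partial_isometries"
  shows "final_projection V \<in> projections"
  unfolding projections_iff partial_isometriesD(6)[OF assms]
  by (auto simp: partial_isometriesD[OF assms] bounded_operators_closed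
      real_adjoint_bounded_operators real_adjoint_compose intro!: blinfun_eqI)


section \<open>Tangent vectors\<close>

text \<open>
  With \<open>Q = 1 - P\<close> the commutator is \<open>TP - PT = QTP - PTQ\<close>. Its two corners have orthogonal
  ranges and act on the orthogonal components \<open>Px\<close> and \<open>Qx\<close>, so the bound follows from
  applying Pythagoras before and after \<open>T\<close>.
\<close>

lemma norm_commutator_projection_le:
  fixes P T :: "'a::{real_inner,banach} \<Rightarrow>\<^sub>L 'a"
  assumes idem: "P o\<^sub>L P = P" and sym: "real_adjoint P = P"
  shows "norm ((T o\<^sub>L P) - (P o\<^sub>L T)) \<le> norm T"
proof (rule norm_blinfun_bound)
  fix x
  have PP: "P (P z) = P z" for z
    using arg_cong[OF idem, of "\<lambda>T. blinfun_apply T z"] by simp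
  have orth: "P z \<bullet> (w - P w) = 0" for z w
    using inner_real_adjoint[of P z "w - P w"] by (simp add: sym PP blinfun.diff_right)
  have pythagoras: "(norm z)\<^sup>2 = (norm (P z))\<^sup>2 + (norm (z - P z))\<^sup>2" for z
    using norm_add_Pythagorean[of "P z" "z - P z"] orth[of z z] by (simp add: orthogonal_def)
  define y where "y = ((T o\<^sub>L P) - (P o\<^sub>L T)) x"
  have y1: "P y = - P (T (x - P x))" and y2: "y - P y = T (P x) - P (T (P x))"
    by (simp_all add: y_def blinfun.bilinear_simps PP)
  have "(norm y)\<^sup>2 = (norm (P (T (x - P x))))\<^sup>2 + (norm (T (P x) - P (T (P x))))\<^sup>2"
    using pythagoras[of y, unfolded y2] by (simp add: y1)
  also have "\<dots> \<le> (norm (T (x - P x)))\<^sup>2 + (norm (T (P x)))\<^sup>2"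
    using pythagoras[of "T (x - P x)"] pythagoras[of "T (P x)"] by simp
  also have "\<dots> \<le> (norm T * norm (x - P x))\<^sup>2 + (norm T * norm (P x))\<^sup>2"
    by (intro add_mono power_mono norm_blinfun) auto
  also have "\<dots> = (norm T * norm x)\<^sup>2"
    using pythagoras[of x] by (simp add: power_mult_distrib algebra_simps)
  finally show "norm (((T o\<^sub>L P) - (P o\<^sub>L T)) x) \<le> norm T * norm x"
    unfolding y_def by (rule power2_le_imp_le) simp
qed simp

text \<open>
  From \<open>v = iAV - iVB\<close> and \<open>v\<^sup>* = iBV\<^sup>* - iV\<^sup>*A\<close>, the terms \<open>V\<^sup>*AV\<close> cancel in \<open>V\<^sup>*v + v\<^sup>*V\<close> and
  the terms \<open>VBV\<^sup>*\<close> cancel in \<open>Vv\<^sup>* + vV\<^sup>*\<close>, which leaves the commutators \<open>i(BE - EB)\<close> and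
  \<open>i(AF - FA)\<close>.
\<close>

lemma
  assumes V: "V \<in> partial_isometries"
    and A: "A \<in> selfadjoint_operators" and B: "B \<in> selfadjoint_operators"
    and v: "scaleC_op \<i> (A o\<^sub>L V) - scaleC_op \<i> (V o\<^sub>L B) = v"
  shows norm_initial_derivative_le:
      "norm ((real_adjoint V o\<^sub>L v) + (real_adjoint v o\<^sub>L V)) \<le> norm B"
    and norm_final_derivative_le:
      "norm ((V o\<^sub>L real_adjoint v) + (v o\<^sub>L real_adjoint V)) \<le> norm A"
proof -
  note V' = partial_isometriesD[OF V]
  have bo: "V \<in> bounded_operators" "real_adjoint V \<in> bounded_operators" "A \<in> bounded_operators"
      "B \<in> bounded_operators"
    and sa: "real_adjoint A = A" "real_adjoint B = B"
    using A B V' by (auto simp: selfadjoint_operators_iff real_adjoint_bounded_operators)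
  have norm_i: "norm (scaleC_op \<i> T) \<le> norm T" for T :: "'a \<Rightarrow>\<^sub>L 'a"
    by (rule norm_blinfun_bound) (simp_all add: norm_scaleC norm_blinfun)
  have v_adj: "real_adjoint v
      = scaleC_op (- \<i>) (real_adjoint V o\<^sub>L A) - scaleC_op (- \<i>) (B o\<^sub>L real_adjoint V)"
    by (simp add: real_adjoint_diff real_adjoint_scaleC_op real_adjoint_compose
        bounded_operators_closed bo sa flip: v)
  define E F where "E = real_adjoint V o\<^sub>L V" and "F = V o\<^sub>L real_adjoint V"
  have EF: "E \<in> projections" "F \<in> projections"
    using initial_projection_in_projections[OF V] final_projection_in_projections[OF V]
    by (simp_all add: V' E_def F_def)
  have "(real_adjoint V o\<^sub>L v) + (real_adjoint v o\<^sub>L V) = scaleC_op \<i> ((B o\<^sub>L E) - (E o\<^sub>L B))"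
    unfolding v_adj
    by (rule blinfun_eqI)
      (simp add: v[symmetric] E_def blinfun.bilinear_simps bounded_operators_scaleC bo
        scaleC_diff_right scaleC_minus_left)
  also have "norm \<dots> \<le> norm B"
    using norm_i norm_commutator_projection_le EF unfolding projections_iff
    by (meson order_trans)
  finally show "norm ((real_adjoint V o\<^sub>L v) + (real_adjoint v o\<^sub>L V)) \<le> norm B" .
  have "(V o\<^sub>L real_adjoint v) + (v o\<^sub>L real_adjoint V) = scaleC_op \<i> ((A o\<^sub>L F) - (F o\<^sub>L A))"
    unfolding v_adj
    by (rule blinfun_eqI)
      (simp add: v[symmetric] F_def blinfun.bilinear_simps bounded_operators_scaleC bo
        scaleC_diff_right scaleC_minus_left)
  also have "norm \<dots> \<le> norm A"
    using norm_i norm_commutator_projection_le EF unfolding projections_iff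
    by (meson order_trans)
  finally show "norm ((V o\<^sub>L real_adjoint v) + (v o\<^sub>L real_adjoint V)) \<le> norm A" .
qed

text \<open>
  Write \<open>E = V\<^sup>*V\<close> and \<open>F = VV\<^sup>*\<close>. Multiplying the tangency equation by \<open>1 - F\<close> and \<open>1 - E\<close> shows
  that \<open>v\<close> has no corner \<open>(1 - F)v(1 - E)\<close>, hence \<open>v = vE + Fv(1 - E)\<close>; multiplying it by \<open>F\<close> and
  \<open>V\<^sup>*\<close> shows that \<open>FvV\<^sup>*\<close> is skew-adjoint. It suffices to find skew-adjoint \<open>S\<close> and \<open>T\<close> with
  \<open>SV = vE\<close> and \<open>VT = - Fv(1 - E)\<close>, for then \<open>A = - iS\<close> and \<open>B = - iT\<close> are as required. Up to
  a multiple of \<open>1 - F\<close> on the right, \<open>S\<close> must be \<open>vV\<^sup>*\<close>, and the correction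
  \<open>- V v\<^sup>* (1 - F)\<close> makes it skew-adjoint without changing \<open>SV\<close>; similarly, \<open>T\<close> is
  \<open>- V\<^sup>*v(1 - E)\<close> minus its adjoint, which \<open>V\<close> annihilates.
\<close>

lemma tangent_vector_decomposition:
  assumes V: "V \<in> partial_isometries" and v: "v \<in> bounded_operators"
    and tangent: "(v o\<^sub>L real_adjoint V o\<^sub>L V) + (V o\<^sub>L real_adjoint v o\<^sub>L V)
      + (V o\<^sub>L real_adjoint V o\<^sub>L v) = v"
  obtains A B where "A \<in> selfadjoint_operators" "B \<in> selfadjoint_operators"
    "scaleC_op \<i> (A o\<^sub>L V) - scaleC_op \<i> (V o\<^sub>L B) = v"
proof -
  note V' = partial_isometriesD[OF V]
  define W w where "W = real_adjoint V" and "w = real_adjoint v"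
  have adj: "real_adjoint V = W" "real_adjoint v = w" "real_adjoint W = V" "real_adjoint w = v"
    by (simp_all add: W_def w_def)
  have bo: "V \<in> bounded_operators" "W \<in> bounded_operators" "v \<in> bounded_operators"
      "w \<in> bounded_operators"
    unfolding W_def w_def using V' v by (auto intro: real_adjoint_bounded_operators)
  have VWV: "V (W (V x)) = V x" and WVW: "W (V (W x)) = W x" for x
    unfolding W_def by (simp_all add: V')
  have v_eq: "v x = v (W (V x)) + V (w (V x)) + V (W (v x))" for x
    using arg_cong[OF tangent, of "\<lambda>T. blinfun_apply T x"] by (simp add: blinfun.bilinear_simps adj)
  have skew: "V (w (V (W x))) = - V (W (v (W x)))" for x
  proof -
    have "V (w (V (W x))) + V (W (v (W x))) = 0"
      using v_eq[of "W x"] unfolding WVW by (metis add.assoc add_cancel_right_right)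
    then show ?thesis by (simp add: eq_neg_iff_add_eq_0)
  qed
  define S where "S = (v o\<^sub>L W) - (V o\<^sub>L w) + (V o\<^sub>L w o\<^sub>L V o\<^sub>L W)"
  define T where "T = (w o\<^sub>L V) - (W o\<^sub>L v) + (W o\<^sub>L v o\<^sub>L W o\<^sub>L V) - (W o\<^sub>L V o\<^sub>L w o\<^sub>L V)"
  have bo_ST: "S \<in> bounded_operators" "T \<in> bounded_operators"
    unfolding S_def T_def by (intro bounded_operators_closed bo)+
  have S_skew: "real_adjoint S x = - S x" for x
    by (simp add: S_def real_adjoint_compose real_adjoint_diff real_adjoint_add adj
        blinfun.bilinear_simps skew)
  have T_skew: "real_adjoint T x = - T x" for x
    by (simp add: T_def real_adjoint_compose real_adjoint_diff real_adjoint_add adj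
        blinfun.bilinear_simps)
  have sa: "scaleC_op (- \<i>) R \<in> selfadjoint_operators"
    if "R \<in> bounded_operators" "\<And>x. real_adjoint R x = - R x" for R :: "'a \<Rightarrow>\<^sub>L 'a"
    unfolding selfadjoint_operators_iff
  proof
    show "real_adjoint (scaleC_op (- \<i>) R) = scaleC_op (- \<i>) R"
      by (rule blinfun_eqI)
        (simp add: real_adjoint_scaleC_op that scaleC_minus_left scaleC_minus_right)
  qed (simp add: that scaleC_op_bounded_operators)
  show thesis
  proof (rule that[OF sa[OF bo_ST(1) S_skew] sa[OF bo_ST(2) T_skew]], rule blinfun_eqI)
    fix x
    \<comment> \<open>the right-hand side is \<open>vE + Fv - FvE = v - (1 - F)v(1 - E)\<close>\<close>
    have "S (V x) - V (T x) = v (W (V x)) + V (W (v x)) - V (W (v (W (V x))))"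
      by (simp add: S_def T_def blinfun.bilinear_simps VWV)
    also have "\<dots> = v (W (V x)) + V (w (V x)) + V (W (v x))"
      using skew[of "V x"] by (simp add: VWV)
    also have "\<dots> = v x"
      by (rule v_eq[symmetric])
    finally show "(scaleC_op \<i> (scaleC_op (- \<i>) S o\<^sub>L V)
        - scaleC_op \<i> (V o\<^sub>L scaleC_op (- \<i>) T)) x = v x"
      by (simp add: blinfun.bilinear_simps bounded_operators_scaleC[OF bo(1)] scaleC_scaleC)
  qed
qed

lemma projection_derivatives_le_partial_isometry_norm:
  assumes V: "V \<in> partial_isometries" and v: "v \<in> bounded_operators"
    and tangent: "(v o\<^sub>L real_adjoint V o\<^sub>L V) + (V o\<^sub>L real_adjoint v o\<^sub>L V)
      + (V o\<^sub>L real_adjoint V o\<^sub>L v) = v"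
  shows "norm ((real_adjoint V o\<^sub>L v) + (real_adjoint v o\<^sub>L V)) \<le> partial_isometry_norm V v"
    and "norm ((V o\<^sub>L real_adjoint v) + (v o\<^sub>L real_adjoint V)) \<le> partial_isometry_norm V v"
proof -
  define N where "N = {max (norm A) (norm B) | A B.
      A \<in> selfadjoint_operators \<and> B \<in> selfadjoint_operators \<and>
      scaleC_op \<i> (A o\<^sub>L V) - scaleC_op \<i> (V o\<^sub>L B) = v}"
  have nonempty: "N \<noteq> {}"
    unfolding N_def using tangent_vector_decomposition[OF assms] by blast
  have bounds: "norm ((real_adjoint V o\<^sub>L v) + (real_adjoint v o\<^sub>L V)) \<le> r \<and>
      norm ((V o\<^sub>L real_adjoint v) + (v o\<^sub>L real_adjoint V)) \<le> r" if r: "r \<in> N" for r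
  proof -
    obtain A B where "r = max (norm A) (norm B)" "A \<in> selfadjoint_operators"
        "B \<in> selfadjoint_operators" "scaleC_op \<i> (A o\<^sub>L V) - scaleC_op \<i> (V o\<^sub>L B) = v"
      using r unfolding N_def by blast
    then show ?thesis
      using norm_initial_derivative_le[OF V] norm_final_derivative_le[OF V]
      by (metis max.coboundedI1 max.coboundedI2)
  qed
  show "norm ((real_adjoint V o\<^sub>L v) + (real_adjoint v o\<^sub>L V)) \<le> partial_isometry_norm V v"
    "norm ((V o\<^sub>L real_adjoint v) + (v o\<^sub>L real_adjoint V)) \<le> partial_isometry_norm V v"
    unfolding partial_isometry_norm_def N_def[symmetric]
    using nonempty bounds by (blast intro: cInf_greatest)+
qed


section \<open>Curves and lengths\<close>

lemma vector_derivative_curve: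
  assumes "a < b" "t \<in> {a..b}" "(\<gamma> has_vector_derivative v) (at t within {a..b})"
  shows "vector_derivative \<gamma> (at t within {a..b}) = v"
  using assms vector_derivative_within_cbox[of a b t \<gamma> v] by simp

lemma smooth_curve_on_has_vector_derivative:
  assumes "smooth_curve_on a b \<gamma>" "t \<in> {a..b}"
  shows "(\<gamma> has_vector_derivative vector_derivative \<gamma> (at t within {a..b})) (at t within {a..b})"
proof -
  obtain D where D: "\<And>t. t \<in> {a..b} \<Longrightarrow> D 0 t = \<gamma> t"
      "\<And>n t. t \<in> {a..b} \<Longrightarrow> (D n has_vector_derivative D (Suc n) t) (at t within {a..b})"
    using assms(1) unfolding smooth_curve_on_def by metis
  have "(\<gamma> has_vector_derivative D 1 t) (at t within {a..b})"
    using has_vector_derivative_transform[OF assms(2) _ D(2)[of t 0]] D(1) assms(2) by simp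
  then show ?thesis
    using differentiableI_vector vector_derivative_works by blast
qed

lemma smooth_curve_on_bounded_linear:
  assumes "bounded_linear L" "smooth_curve_on a b \<gamma>"
  shows "smooth_curve_on a b (\<lambda>t. L (\<gamma> t))"
proof -
  obtain D where D: "\<And>t. t \<in> {a..b} \<Longrightarrow> D 0 t = \<gamma> t"
      "\<And>n t. t \<in> {a..b} \<Longrightarrow> (D n has_vector_derivative D (Suc n) t) (at t within {a..b})"
    using assms(2) unfolding smooth_curve_on_def by metis
  then show ?thesis
    unfolding smooth_curve_on_def
    by (intro exI[of _ "\<lambda>n t. L (D n t)"])
      (auto intro: bounded_linear.has_vector_derivative[OF assms(1)])
qed

text \<open>
  The derivatives of the product are given by the Leibniz formula; Pascal's rule shows that its
  right-hand sides form a sequence of successive derivatives.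
\<close>

lemma (in bounded_bilinear) smooth_curve_on_prod:
  assumes "smooth_curve_on a b f" "smooth_curve_on a b g"
  shows "smooth_curve_on a b (\<lambda>t. prod (f t) (g t))"
proof -
  obtain D where D: "\<And>t. t \<in> {a..b} \<Longrightarrow> D 0 t = f t"
      "\<And>n t. t \<in> {a..b} \<Longrightarrow> (D n has_vector_derivative D (Suc n) t) (at t within {a..b})"
    using assms(1) unfolding smooth_curve_on_def by metis
  obtain G where G: "\<And>t. t \<in> {a..b} \<Longrightarrow> G 0 t = g t"
      "\<And>n t. t \<in> {a..b} \<Longrightarrow> (G n has_vector_derivative G (Suc n) t) (at t within {a..b})"
    using assms(2) unfolding smooth_curve_on_def by metis
  define H where "H n t = (\<Sum>k\<le>n. real (n choose k) *\<^sub>R prod (D k t) (G (n - k) t))" for n t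
  have pascal: "H (Suc n) t = (\<Sum>k\<le>n. real (n choose k) *\<^sub>R
      (prod (D k t) (G (Suc (n - k)) t) + prod (D (Suc k) t) (G (n - k) t)))" for n t
  proof -
    define c where "c k = prod (D k t) (G (Suc n - k) t)" for k
    have "(\<Sum>k\<le>n. real (n choose k) *\<^sub>R c k) = (\<Sum>k\<le>Suc n. real (n choose k) *\<^sub>R c k)"
      by simp
    also have "\<dots> = c 0 + (\<Sum>k\<le>n. real (n choose Suc k) *\<^sub>R c (Suc k))"
      by (subst sum.atMost_Suc_shift) simp
    finally have shift: "(\<Sum>k\<le>n. real (n choose k) *\<^sub>R c k)
        = c 0 + (\<Sum>k\<le>n. real (n choose Suc k) *\<^sub>R c (Suc k))" .
    have "H (Suc n) t = c 0 + (\<Sum>k\<le>n. real (Suc n choose Suc k) *\<^sub>R c (Suc k))"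
      unfolding H_def c_def by (subst sum.atMost_Suc_shift) simp
    also have "\<dots> = (\<Sum>k\<le>n. real (n choose k) *\<^sub>R c k)
        + (\<Sum>k\<le>n. real (n choose k) *\<^sub>R c (Suc k))"
      by (simp add: shift scaleR_add_left sum.distrib)
    also have "\<dots> = (\<Sum>k\<le>n. real (n choose k) *\<^sub>R (c k + c (Suc k)))"
      by (simp add: scaleR_add_right sum.distrib)
    also have "\<dots> = (\<Sum>k\<le>n. real (n choose k) *\<^sub>R
        (prod (D k t) (G (Suc (n - k)) t) + prod (D (Suc k) t) (G (n - k) t)))"
      by (intro sum.cong) (auto simp: c_def Suc_diff_le)
    finally show ?thesis .
  qed
  have "(H n has_vector_derivative H (Suc n) t) (at t within {a..b})" if "t \<in> {a..b}" for n t
    unfolding pascal unfolding H_def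
    by (intro has_vector_derivative_sum bounded_linear.has_vector_derivative[OF bounded_linear_scaleR_right]
        has_vector_derivative D G that)
  moreover have "H 0 t = prod (f t) (g t)" if "t \<in> {a..b}" for t
    using that by (simp add: H_def D G)
  ultimately show ?thesis
    unfolding smooth_curve_on_def by blast
qed

text \<open>
  The hypothesis on speeds is the pointwise bound by which a map is a contraction on tangent
  spaces, phrased along curves so that its derivative need not be named.
\<close>

lemma finsler_dist_image_le:
  assumes smooth: "\<And>a b \<gamma>. a < b \<Longrightarrow> smooth_curve_on a b \<gamma> \<Longrightarrow> \<gamma> ` {a..b} \<subseteq> M \<Longrightarrow>
      smooth_curve_on a b (\<lambda>t. f (\<gamma> t))"
    and maps: "f ` M \<subseteq> M'"
    and speed: "\<And>a b \<gamma> t. a < b \<Longrightarrow> smooth_curve_on a b \<gamma> \<Longrightarrow> \<gamma> ` {a..b} \<subseteq> M \<Longrightarrow> t \<in> {a..b} \<Longrightarrow>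
      N' (f (\<gamma> t)) (vector_derivative (\<lambda>t. f (\<gamma> t)) (at t within {a..b}))
        \<le> N (\<gamma> t) (vector_derivative \<gamma> (at t within {a..b}))"
  shows "finsler_dist M' N' (f x) (f y) \<le> finsler_dist M N x y"
  unfolding finsler_dist_def
proof (rule Inf_mono, clarify)
  fix a b :: real and \<gamma>
  assume \<gamma>: "a < b" "smooth_curve_on a b \<gamma>" "\<gamma> ` {a..b} \<subseteq> M"
  have "curve_length N' a b (\<lambda>t. f (\<gamma> t)) \<le> curve_length N a b \<gamma>"
    unfolding curve_length_def
    by (intro nn_integral_mono) (auto simp: indicator_def intro!: ennreal_leI speed \<gamma>)
  moreover have "(\<lambda>t. f (\<gamma> t)) ` {a..b} \<subseteq> M'"
    using maps \<gamma>(3) by blast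
  ultimately show "\<exists>l\<in>{curve_length N' a' b' \<delta> |a' b' \<delta>. a' < b' \<and> smooth_curve_on a' b' \<delta> \<and>
      \<delta> ` {a'..b'} \<subseteq> M' \<and> \<delta> a' = f (\<gamma> a) \<and> \<delta> b' = f (\<gamma> b)}. l \<le> curve_length N a b \<gamma>"
    using \<gamma> smooth by (intro bexI[of _ "curve_length N' a b (\<lambda>t. f (\<gamma> t))"]) blast+
qed

lemma smooth_curve_on_cong:
  assumes "smooth_curve_on a b f" "\<And>t. t \<in> {a..b} \<Longrightarrow> f t = g t"
  shows "smooth_curve_on a b g"
  using assms unfolding smooth_curve_on_def by force

text \<open>
  Complex linearity of an operator is a family of bounded linear equations on it, one for each
  scalar and vector, and such equations pass to derivatives.
\<close>

lemma derivative_in_bounded_operators: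
  assumes "a < b" "t \<in> {a..b}" "\<gamma> ` {a..b} \<subseteq> bounded_operators"
    and \<gamma>': "(\<gamma> has_vector_derivative v) (at t within {a..b})"
  shows "v \<in> bounded_operators"
  unfolding bounded_operators_def
proof (intro CollectI allI)
  fix c and x :: 'a
  have lin: "bounded_linear (\<lambda>T. blinfun_apply T (c *\<^sub>C x) - blinfun_apply (scaleC_op c id_blinfun) (blinfun_apply T x))"
    by (intro bounded_linear_intros)
  have "((\<lambda>s. \<gamma> s (c *\<^sub>C x) - scaleC_op c id_blinfun (\<gamma> s x)) has_vector_derivative
      v (c *\<^sub>C x) - scaleC_op c id_blinfun (v x)) (at t within {a..b})"
    by (rule bounded_linear.has_vector_derivative[OF lin \<gamma>'])
  then have "((\<lambda>s. 0) has_vector_derivative v (c *\<^sub>C x) - scaleC_op c id_blinfun (v x))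
      (at t within {a..b})"
    by (rule has_vector_derivative_transform[OF assms(2), rotated])
      (use assms(3) in \<open>auto simp: image_subset_iff bounded_operators_scaleC\<close>)
  then have "v (c *\<^sub>C x) - scaleC_op c id_blinfun (v x) = 0"
    using vector_derivative_curve[OF assms(1,2)] has_vector_derivative_const by metis
  then show "v (c *\<^sub>C x) = c *\<^sub>C v x"
    by simp
qed

lemma partial_isometry_curve:
  fixes \<gamma> :: "real \<Rightarrow> 'a::complex_hilbert \<Rightarrow>\<^sub>L 'a"
  assumes ab: "a < b" and \<gamma>: "smooth_curve_on a b \<gamma>" "\<gamma> ` {a..b} \<subseteq> partial_isometries"
  shows "smooth_curve_on a b (\<lambda>t. initial_projection (\<gamma> t))"
    and "smooth_curve_on a b (\<lambda>t. final_projection (\<gamma> t))"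
    and "t \<in> {a..b} \<Longrightarrow>
      norm (vector_derivative (\<lambda>t. initial_projection (\<gamma> t)) (at t within {a..b}))
        \<le> partial_isometry_norm (\<gamma> t) (vector_derivative \<gamma> (at t within {a..b}))"
    and "t \<in> {a..b} \<Longrightarrow>
      norm (vector_derivative (\<lambda>t. final_projection (\<gamma> t)) (at t within {a..b}))
        \<le> partial_isometry_norm (\<gamma> t) (vector_derivative \<gamma> (at t within {a..b}))"
proof -
  have pi: "\<gamma> s \<in> partial_isometries" if "s \<in> {a..b}" for s
    using \<gamma>(2) that by blast
  note \<gamma>_adj = smooth_curve_on_bounded_linear[OF bounded_linear_real_adjoint \<gamma>(1)]
  show "smooth_curve_on a b (\<lambda>t. initial_projection (\<gamma> t))"
    by (rule smooth_curve_on_cong[OF bounded_bilinear.smooth_curve_on_prod[OF bounded_bilinear_blinfun_compose \<gamma>_adj \<gamma>(1)]])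
      (simp add: partial_isometriesD(5)[OF pi])
  show "smooth_curve_on a b (\<lambda>t. final_projection (\<gamma> t))"
    by (rule smooth_curve_on_cong[OF bounded_bilinear.smooth_curve_on_prod[OF bounded_bilinear_blinfun_compose \<gamma>(1) \<gamma>_adj]])
      (simp add: partial_isometriesD(6)[OF pi])
  assume t: "t \<in> {a..b}"
  define v where "v = vector_derivative \<gamma> (at t within {a..b})"
  have d: "(\<gamma> has_vector_derivative v) (at t within {a..b})"
    unfolding v_def by (rule smooth_curve_on_has_vector_derivative[OF \<gamma>(1) t])
  note d_adj = bounded_linear.has_vector_derivative[OF bounded_linear_real_adjoint d]
  have v_bo: "v \<in> bounded_operators"
    using derivative_in_bounded_operators[OF ab t _ d] \<gamma>(2) partial_isometriesD(1) by blast
  \<comment> \<open>the tangency equation is the derivative of \<open>VV\<^sup>*V = V\<close>\<close>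
  note dV = bounded_bilinear.has_vector_derivative[OF bounded_bilinear_blinfun_compose bounded_bilinear.has_vector_derivative[OF bounded_bilinear_blinfun_compose d d_adj] d]
  have "(\<gamma> has_vector_derivative
      (\<gamma> t o\<^sub>L real_adjoint (\<gamma> t) o\<^sub>L v) + ((\<gamma> t o\<^sub>L real_adjoint v) + (v o\<^sub>L real_adjoint (\<gamma> t)) o\<^sub>L \<gamma> t))
      (at t within {a..b})"
    by (rule has_vector_derivative_transform[OF t _ dV]) (simp add: partial_isometriesD(2)[OF pi])
  then have "v = (\<gamma> t o\<^sub>L real_adjoint (\<gamma> t) o\<^sub>L v)
      + ((\<gamma> t o\<^sub>L real_adjoint v) + (v o\<^sub>L real_adjoint (\<gamma> t)) o\<^sub>L \<gamma> t)"
    using vector_derivative_curve[OF ab t] d by metis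
  then have tangent: "(v o\<^sub>L real_adjoint (\<gamma> t) o\<^sub>L \<gamma> t) + (\<gamma> t o\<^sub>L real_adjoint v o\<^sub>L \<gamma> t)
      + (\<gamma> t o\<^sub>L real_adjoint (\<gamma> t) o\<^sub>L v) = v"
    by (simp add: bounded_bilinear.add_left[OF bounded_bilinear_blinfun_compose] add_ac)
  have "((\<lambda>t. initial_projection (\<gamma> t)) has_vector_derivative
      (real_adjoint (\<gamma> t) o\<^sub>L v) + (real_adjoint v o\<^sub>L \<gamma> t)) (at t within {a..b})"
    by (rule has_vector_derivative_transform[OF t _ bounded_bilinear.has_vector_derivative[OF bounded_bilinear_blinfun_compose d_adj d]])
      (simp add: partial_isometriesD(5)[OF pi])
  then show "norm (vector_derivative (\<lambda>t. initial_projection (\<gamma> t)) (at t within {a..b}))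
      \<le> partial_isometry_norm (\<gamma> t) v"
    using projection_derivatives_le_partial_isometry_norm(1)[OF pi[OF t] v_bo tangent]
    by (simp add: vector_derivative_curve[OF ab t])
  have "((\<lambda>t. final_projection (\<gamma> t)) has_vector_derivative
      (\<gamma> t o\<^sub>L real_adjoint v) + (v o\<^sub>L real_adjoint (\<gamma> t))) (at t within {a..b})"
    by (rule has_vector_derivative_transform[OF t _ bounded_bilinear.has_vector_derivative[OF bounded_bilinear_blinfun_compose d d_adj]])
      (simp add: partial_isometriesD(6)[OF pi])
  then show "norm (vector_derivative (\<lambda>t. final_projection (\<gamma> t)) (at t within {a..b}))
      \<le> partial_isometry_norm (\<gamma> t) v"
    using projection_derivatives_le_partial_isometry_norm(2)[OF pi[OF t] v_bo tangent]
    by (simp add: vector_derivative_curve[OF ab t])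
qed

theorem proposition6p1:
  shows "(initial_projection :: ('a::complex_hilbert \<Rightarrow>\<^sub>L 'a) \<Rightarrow> ('a \<Rightarrow>\<^sub>L 'a))
      \<in> partial_isometries \<rightarrow> projections
    \<and> (final_projection :: ('a \<Rightarrow>\<^sub>L 'a) \<Rightarrow> ('a \<Rightarrow>\<^sub>L 'a)) \<in> partial_isometries \<rightarrow> projections
    \<and> (\<forall>V1 \<in> (partial_isometries :: ('a \<Rightarrow>\<^sub>L 'a) set). \<forall>V2 \<in> partial_isometries.
        projection_dist (initial_projection V1) (initial_projection V2)
          \<le> partial_isometry_dist V1 V2
      \<and> projection_dist (final_projection V1) (final_projection V2)
          \<le> partial_isometry_dist V1 V2)"
  unfolding projection_dist_def partial_isometry_dist_def
  by (intro conjI ballI finsler_dist_image_le)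
    (auto simp: initial_projection_in_projections final_projection_in_projections
      intro: partial_isometry_curve)

end
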